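(* No type 2 functional computes a weak Cantor realiser: there is no functional $F:\mathbb{N}^{\mathbb{N}}\rightarrow\mathbb{N}$ such that some weak Cantor realiser is Kleene-computable in $F$.
   Context: Computability is Kleene's higher-order computability via S1–S9; metatheory ZFC. Sets $A\subseteq[0,1]$ are given by characteristic functions. $Y:[0,1]\rightarrow\mathbb{N}$ is bijective on $A$ if $(\forall x,y\in A)(Y(x)=Y(y)\rightarrow x=y)$ and $(\forall n\in\mathbb{N})(\exists x\in A)(Y(x)=n)$. A weak Cantor realiser is a (partial) functional which, on input any $A\subseteq[0,1]$ and $Y:[0,1]\rightarrow\mathbb{N}$ bijective on $A$, outputs some $x\in[0,1]$ with $x\notin A$. *)

theory Defs
  imports "HOL-Analysis.Analysis" "HOL-Library.Nat_Bijection" "HOL-Library.Countable"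
begin

section \<open>Kleene computability\<close>

text \<open>
  Kleene's S1--S9 for arguments of type at most 2: \<open>kleene e as fs Gs c\<close> means
  \<open>{e}(as, fs, Gs) \<simeq> c\<close>. As in Kleene's original presentation, the arguments are grouped by type:
  \<open>as\<close> lists the arguments of type 0, \<open>fs\<close> those of type 1 and \<open>Gs\<close> those of type 2, the relative
  order of arguments of different types being immaterial. S8 for an object of type \<open>j\<close> introduces an
  argument of type \<open>j - 2\<close>, so the schemes below are all the instances that occur in a computation
  whose arguments have type at most 2.
  In S6, the second entry of the index is the type of the argument which is moved to the front.
  In S8, \<open>u\<close> has to be total, as type-2 objects only accept total arguments.
  In S9, the \<open>m\<^sub>j\<close> say how many of the arguments of type \<open>j\<close> are kept.
\<close>

definition move_to_front :: "nat \<Rightarrow> 'a list \<Rightarrow> 'a list" where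
  "move_to_front k xs = xs ! k # take k xs @ drop (Suc k) xs"

inductive kleene ::
  "nat \<Rightarrow> nat list \<Rightarrow> (nat \<Rightarrow> nat) list \<Rightarrow> ((nat \<Rightarrow> nat) \<Rightarrow> nat) list \<Rightarrow> nat \<Rightarrow> bool"
where
  S1: "kleene (list_encode [1]) (a # as) fs Gs (Suc a)"
| S2: "kleene (list_encode [2, q]) as fs Gs q"
| S3: "kleene (list_encode [3]) (a # as) fs Gs a"
| S4: "kleene h as fs Gs b \<Longrightarrow> kleene g (b # as) fs Gs c \<Longrightarrow>
       kleene (list_encode [4, g, h]) as fs Gs c"
| S5_0: "kleene g as fs Gs c \<Longrightarrow> kleene (list_encode [5, g, h]) (0 # as) fs Gs c"
| S5_Suc: "kleene (list_encode [5, g, h]) (a # as) fs Gs b \<Longrightarrow> kleene h (a # b # as) fs Gs c \<Longrightarrow>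
       kleene (list_encode [5, g, h]) (Suc a # as) fs Gs c"
| S6_0: "k < length as \<Longrightarrow> kleene g (move_to_front k as) fs Gs c \<Longrightarrow>
       kleene (list_encode [6, 0, k, g]) as fs Gs c"
| S6_1: "k < length fs \<Longrightarrow> kleene g as (move_to_front k fs) Gs c \<Longrightarrow>
       kleene (list_encode [6, 1, k, g]) as fs Gs c"
| S6_2: "k < length Gs \<Longrightarrow> kleene g as fs (move_to_front k Gs) c \<Longrightarrow>
       kleene (list_encode [6, 2, k, g]) as fs Gs c"
| S7: "kleene (list_encode [7]) (a # as) (f # fs) Gs (f a)"
| S8: "(\<And>n. kleene h (n # as) fs (G # Gs) (u n)) \<Longrightarrow>
       kleene (list_encode [8, 2, h]) as fs (G # Gs) (G u)"
| S9: "m\<^sub>0 \<le> length as \<Longrightarrow> m\<^sub>1 \<le> length fs \<Longrightarrow> m\<^sub>2 \<le> length Gs \<Longrightarrow>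
       kleene a (take m\<^sub>0 as) (take m\<^sub>1 fs) (take m\<^sub>2 Gs) c \<Longrightarrow>
       kleene (list_encode [9, m\<^sub>0, m\<^sub>1, m\<^sub>2]) (a # as) fs Gs c"

context
  notes list_encode.simps [simp del] list_encode_eq [simp]
begin

inductive_cases kleene_S1E: "kleene (list_encode [1]) as fs Gs d"
inductive_cases kleene_S2E: "kleene (list_encode [2, q]) as fs Gs d"
inductive_cases kleene_S3E: "kleene (list_encode [3]) as fs Gs d"
inductive_cases kleene_S4E: "kleene (list_encode [4, g, h]) as fs Gs d"
inductive_cases kleene_S5_0E: "kleene (list_encode [5, g, h]) (0 # as) fs Gs d"
inductive_cases kleene_S5_SucE: "kleene (list_encode [5, g, h]) (Suc a # as) fs Gs d"
inductive_cases kleene_S6_0E: "kleene (list_encode [6, 0, k, g]) as fs Gs d"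
inductive_cases kleene_S6_1E: "kleene (list_encode [6, 1, k, g]) as fs Gs d"
inductive_cases kleene_S6_2E: "kleene (list_encode [6, 2, k, g]) as fs Gs d"
inductive_cases kleene_S7E: "kleene (list_encode [7]) as fs Gs d"
inductive_cases kleene_S8E: "kleene (list_encode [8, 2, h]) as fs Gs d"
inductive_cases kleene_S9E: "kleene (list_encode [9, m0, m1, m2]) as fs Gs d"

end

lemma kleene_deterministic:
  "kleene e as fs Gs c \<Longrightarrow> kleene e as fs Gs d \<Longrightarrow> c = d"
proof (induction arbitrary: d rule: kleene.induct)
  case S1 from S1.prems show ?case by (rule kleene_S1E) auto
next
  case S2 from S2.prems show ?case by (rule kleene_S2E) auto
next
  case S3 from S3.prems show ?case by (rule kleene_S3E) auto
next
  case S4 from S4.prems show ?case by (rule kleene_S4E) (metis S4.IH)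
next
  case S5_0 from S5_0.prems show ?case by (rule kleene_S5_0E) (use S5_0.IH in auto)
next
  case S5_Suc from S5_Suc.prems show ?case by (rule kleene_S5_SucE) (metis S5_Suc.IH)
next
  case S6_0 from S6_0.prems show ?case by (rule kleene_S6_0E) (use S6_0.IH in auto)
next
  case S6_1 from S6_1.prems show ?case by (rule kleene_S6_1E) (use S6_1.IH in auto)
next
  case S6_2 from S6_2.prems show ?case by (rule kleene_S6_2E) (use S6_2.IH in auto)
next
  case S7 from S7.prems show ?case by (rule kleene_S7E) auto
next
  case (S8 h as fs G Gs u)
  from S8.prems obtain v where v: "d = G v" "\<And>n. kleene h (n # as) fs (G # Gs) (v n)"
    by (rule kleene_S8E) auto
  then have "u = v" using S8.IH by blast
  then show ?case using v by simp
next
  case S9 from S9.prems show ?case by (rule kleene_S9E) (use S9.IH in auto)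
qed


section \<open>Elements of the unit interval as type-1 objects\<close>

text \<open>
  Reals are coded by fast converging Cauchy sequences of (coded) rationals. Kohlenbach's hat
  operator replaces a sequence from the first violation of fast convergence onwards by a constant, so
  that every function on the naturals codes a real; the value is then truncated to the unit interval.
\<close>

definition hat :: "(nat \<Rightarrow> rat) \<Rightarrow> nat \<Rightarrow> rat" where
  "hat q n = (if \<forall>k<n. \<bar>q k - q (Suc k)\<bar> < 1 / 2 ^ Suc k then q n
              else q (LEAST k. \<not> \<bar>q k - q (Suc k)\<bar> < 1 / 2 ^ Suc k))"

definition unit_real :: "(nat \<Rightarrow> nat) \<Rightarrow> real" where
  "unit_real f = max 0 (min 1 (lim (\<lambda>n. real_of_rat (hat (nat_to_rat_surj \<circ> f) n))))"

lemma unit_real_in_unit: "unit_real f \<in> {0..1}"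
  by (simp add: unit_real_def)

lemma hat_eq:
  assumes "\<And>k. \<bar>q k - q (Suc k)\<bar> < 1 / 2 ^ Suc k"
  shows "hat q = q"
  using assms by (auto simp: hat_def)

lemma hat_fast: "\<bar>hat q n - hat q (Suc n)\<bar> < 1 / 2 ^ Suc n"
proof (cases "\<forall>k<Suc n. \<bar>q k - q (Suc k)\<bar> < 1 / 2 ^ Suc k")
  case True
  then show ?thesis by (simp add: hat_def)
next
  case False
  let ?P = "\<lambda>k. \<not> \<bar>q k - q (Suc k)\<bar> < 1 / 2 ^ Suc k"
  have "hat q n = q (LEAST k. ?P k)"
  proof (cases "\<forall>k<n. \<not> ?P k")
    case True
    then have "?P n" using False less_Suc_eq by metis
    then have "(LEAST k. ?P k) = n"
      using True by (intro Least_equality) (auto simp: not_less[symmetric])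
    then show ?thesis using True by (simp add: hat_def)
  next
    case False
    then show ?thesis unfolding hat_def by (subst if_not_P) auto
  qed
  moreover have "hat q (Suc n) = q (LEAST k. ?P k)"
    unfolding hat_def using False by (subst if_not_P) auto
  ultimately show ?thesis by simp
qed

lemma unit_real_surj:
  assumes "x \<in> {0..1}"
  shows "\<exists>f. unit_real f = x"
proof -
  have "\<exists>r. \<bar>real_of_rat r - x\<bar> < 1 / 2 ^ (n + 2)" for n
  proof -
    have "x < x + 1 / 2 ^ (n + 2)" by simp
    then obtain r where "x < real_of_rat r" "real_of_rat r < x + 1 / 2 ^ (n + 2)"
      using of_rat_dense by blast
    then show ?thesis by (intro exI[of _ r]) linarith
  qed
  then obtain q where q: "\<And>n. \<bar>real_of_rat (q n) - x\<bar> < 1 / 2 ^ (n + 2)" by metis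
  have fast: "\<bar>q n - q (Suc n)\<bar> < 1 / 2 ^ Suc n" for n
  proof -
    define d :: real where "d = 1 / 2 ^ (n + 2)"
    have "(1::real) / 2 ^ (Suc n + 2) = d / 2" and d: "(1::real) / 2 ^ Suc n = 2 * d" "0 < d"
      by (simp_all add: d_def)
    then have "\<bar>real_of_rat (q n) - x\<bar> < d" "\<bar>real_of_rat (q (Suc n)) - x\<bar> < d / 2"
      using q[of n] q[of "Suc n"] by (simp_all only: d_def)
    then have "\<bar>real_of_rat (q n) - real_of_rat (q (Suc n))\<bar> < 2 * d"
      using d(2) by linarith
    then have "\<bar>real_of_rat (q n) - real_of_rat (q (Suc n))\<bar> < 1 / 2 ^ Suc n"
      by (simp only: d(1))
    then have "real_of_rat \<bar>q n - q (Suc n)\<bar> < real_of_rat (1 / 2 ^ Suc n)"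
      by (auto simp: abs_if of_rat_diff of_rat_minus of_rat_divide of_rat_power of_rat_mult of_rat_less
          split: if_splits)
    then show ?thesis by (simp only: of_rat_less)
  qed
  obtain f where f: "nat_to_rat_surj \<circ> f = q"
  proof
    show "nat_to_rat_surj \<circ> (\<lambda>n. inv nat_to_rat_surj (q n)) = q"
      by (auto simp: surj_f_inv_f[OF surj_nat_to_rat_surj])
  qed
  have "(\<lambda>n. real_of_rat (q n) - x) \<longlonglongrightarrow> 0"
  proof (rule Lim_null_comparison)
    show "\<forall>\<^sub>F n in sequentially. norm (real_of_rat (q n) - x) \<le> (1 / 2) ^ n"
    proof (intro always_eventually allI)
      fix n
      have "(1::real) / 2 ^ (n + 2) \<le> (1 / 2) ^ n" by (simp add: power_divide divide_simps)
      then show "norm (real_of_rat (q n) - x) \<le> (1 / 2) ^ n" using q[of n] by simp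
    qed
  qed (rule LIMSEQ_power_zero, simp)
  then have "(\<lambda>n. real_of_rat (q n)) \<longlonglongrightarrow> x" by (simp add: LIM_zero_iff)
  then have "lim (\<lambda>n. real_of_rat (q n)) = x" by (rule limI)
  then have "unit_real f = x"
    using assms by (simp add: unit_real_def f hat_eq[OF fast])
  then show ?thesis by blast
qed

definition fun_functional :: "(real \<Rightarrow> nat) \<Rightarrow> (nat \<Rightarrow> nat) \<Rightarrow> nat" where
  "fun_functional Y f = Y (unit_real f)"

definition set_functional :: "real set \<Rightarrow> (nat \<Rightarrow> nat) \<Rightarrow> nat" where
  "set_functional A f = (if unit_real f \<in> A then 1 else 0)"


section \<open>Weak Cantor realisers\<close>

text \<open>
  A partial functional taking a subset of the unit interval and a function from the
  unit interval to the naturals to a real. Functions on the unit interval are HOL functions in the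
  extensional function space, \<open>None\<close> stands for an undefined value.
\<close>

definition weak_cantor_realiser :: "(real set \<Rightarrow> (real \<Rightarrow> nat) \<Rightarrow> real option) \<Rightarrow> bool" where
  "weak_cantor_realiser C \<longleftrightarrow>
     (\<forall>A Y. A \<subseteq> {0..1} \<longrightarrow> Y \<in> {0..1} \<rightarrow>\<^sub>E UNIV \<longrightarrow> bij_betw Y A UNIV \<longrightarrow>
        (\<exists>x\<in>{0..1}. C A Y = Some x \<and> x \<notin> A))"

text \<open>
  The value of such a functional is a type-1 object up to coding: it is defined iff the
  computation terminates for every \<open>n\<close>, and is then the real coded by the resulting sequence.
\<close>

definition kleene_computable_in ::
  "((nat \<Rightarrow> nat) \<Rightarrow> nat) \<Rightarrow> (real set \<Rightarrow> (real \<Rightarrow> nat) \<Rightarrow> real option) \<Rightarrow> bool" where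
  "kleene_computable_in F C \<longleftrightarrow>
     (\<exists>e. \<forall>A Y. A \<subseteq> {0..1} \<longrightarrow> Y \<in> {0..1} \<rightarrow>\<^sub>E UNIV \<longrightarrow>
        (\<forall>x. C A Y = Some x \<longleftrightarrow>
           (\<exists>f. (\<forall>n. kleene e [n] [] [F, set_functional A, fun_functional Y] (f n)) \<and>
                unit_real f = x)))"

end

theory Submission
  imports Defs
begin

text \<open>
  Call a computation forced by a partial injection \<open>P\<close> from the unit interval to the naturals if it
  has the same result for all inputs \<open>(A, Y)\<close> extending \<open>P\<close>. By Zorn's lemma there is a maximal
  \<open>P\<close> in which every real is the value of a forced total computation, and is mapped to a code
  of that computation. Since a code determines the computed real, \<open>P\<close> is injective, hence countable.
  By maximality, all reals computed by forced computations already lie in the domain of \<open>P\<close>; so all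
  queries stay in this domain, and every computation relative to an extension of \<open>P\<close> is
  forced. Adding reals outside the domain of \<open>P\<close>, one for each unused code, yields a set \<open>A\<close> on which
  some extension \<open>Y\<close> of \<open>P\<close> is bijective, and a functional computable in \<open>F\<close> can only
  output elements of \<open>A\<close> on the input \<open>(A, Y)\<close>.
\<close>

definition input_extends :: "(real \<times> nat) set \<Rightarrow> real set \<Rightarrow> (real \<Rightarrow> nat) \<Rightarrow> bool" where
  "input_extends P A Y \<longleftrightarrow> (\<forall>(x, c)\<in>P. x \<in> A \<and> Y x = c)"

text \<open>S6 and S9 permute and truncate the list of type-2 arguments, which is therefore represented
  by a list of names that makes sense for all inputs simultaneously.\<close>

definition named_input ::
  "((nat \<Rightarrow> nat) \<Rightarrow> nat) \<Rightarrow> real set \<Rightarrow> (real \<Rightarrow> nat) \<Rightarrow> nat \<Rightarrow> (nat \<Rightarrow> nat) \<Rightarrow> nat" where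
  "named_input F A Y t = (if t = 0 then F else if t = 1 then set_functional A else fun_functional Y)"

text \<open>The list of type-1 arguments stays empty, since S8 for type-2 objects only introduces
  numbers.\<close>

definition forced ::
  "((nat \<Rightarrow> nat) \<Rightarrow> nat) \<Rightarrow> (real \<times> nat) set \<Rightarrow> nat \<Rightarrow> nat list \<Rightarrow> nat list \<Rightarrow> nat \<Rightarrow> bool" where
  "forced F P e as ts c \<longleftrightarrow>
     (\<forall>A Y. input_extends P A Y \<longrightarrow> kleene e as [] (map (named_input F A Y) ts) c)"

text \<open>The triple is the data of the premise of S8, where \<open>n\<close> is the new number
  argument; triples form a countable type, hence have codes \<open>to_nat\<close>.\<close>

definition forced_real ::
  "((nat \<Rightarrow> nat) \<Rightarrow> nat) \<Rightarrow> (real \<times> nat) set \<Rightarrow> nat \<times> nat list \<times> nat list \<Rightarrow> real \<Rightarrow> bool" where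
  "forced_real F P = (\<lambda>(h, as, ts) x. \<exists>u. (\<forall>n. forced F P h (n # as) ts (u n)) \<and> unit_real u = x)"

text \<open>Forcing refers to all of \<open>P\<close>, not to stages of a construction, so
  monotonicity alone carries the second clause through unions of chains.\<close>

definition self_coded :: "((nat \<Rightarrow> nat) \<Rightarrow> nat) \<Rightarrow> (real \<times> nat) set \<Rightarrow> bool" where
  "self_coded F P \<longleftrightarrow>
     single_valued P \<and> (\<forall>(x, c)\<in>P. \<exists>i. c = to_nat i \<and> forced_real F P i x)"

lemma input_extends_mono: "input_extends Q A Y \<Longrightarrow> P \<subseteq> Q \<Longrightarrow> input_extends P A Y"
  unfolding input_extends_def by (rule ballI) (erule bspec, erule subsetD)

lemma forced_mono: "forced F P e as ts c \<Longrightarrow> P \<subseteq> Q \<Longrightarrow> forced F Q e as ts c"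
  unfolding forced_def using input_extends_mono by blast

lemma forced_real_mono: "forced_real F P i x \<Longrightarrow> P \<subseteq> Q \<Longrightarrow> forced_real F Q i x"
  unfolding forced_real_def split_beta using forced_mono by blast

lemma self_coded_forced_real:
  "self_coded F P \<Longrightarrow> (x, c) \<in> P \<Longrightarrow> \<exists>i. c = to_nat i \<and> forced_real F P i x"
  by (auto simp: self_coded_def)

text \<open>Rules out vacuous forcing: without any extending input, every computation would be
  forced to have every result.\<close>

lemma input_extends_exists:
  assumes "single_valued P"
  shows "\<exists>A Y. input_extends P A Y"
proof (intro exI)
  show "input_extends P UNIV (\<lambda>x. THE c. (x, c) \<in> P)"
    using assms by (auto simp: input_extends_def single_valued_def intro!: the_equality)
qed

text \<open>On a single input extending \<open>P\<close>, determinism makes the two computed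
  sequences equal.\<close>

lemma forced_real_unique:
  assumes "single_valued P" "forced_real F P i x" "forced_real F P i y"
  shows "x = y"
proof -
  obtain h as ts where i: "i = (h, as, ts)" by (cases i)
  obtain A Y where AY: "input_extends P A Y" using input_extends_exists[OF assms(1)] by blast
  obtain u where u: "\<And>n. forced F P h (n # as) ts (u n)" "unit_real u = x"
    using assms(2) by (auto simp: forced_real_def i)
  obtain v where v: "\<And>n. forced F P h (n # as) ts (v n)" "unit_real v = y"
    using assms(3) by (auto simp: forced_real_def i)
  have "u n = v n" for n
    using u(1)[of n] v(1)[of n] AY kleene_deterministic unfolding forced_def by blast
  then show ?thesis using u(2) v(2) by (metis ext)
qed

lemma forced_real_in_unit: "forced_real F P i x \<Longrightarrow> x \<in> {0..1}"
  using unit_real_in_unit by (auto simp: forced_real_def simp del: atLeastAtMost_iff split: prod.splits)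

lemma self_coded_inverse_single_valued:
  assumes "self_coded F P"
  shows "single_valued (P\<inverse>)"
proof (rule single_valuedI)
  fix c x y
  assume "(c, x) \<in> P\<inverse>" "(c, y) \<in> P\<inverse>"
  then obtain i j where "c = to_nat i" "forced_real F P i x" "c = to_nat j" "forced_real F P j y"
    using self_coded_forced_real[OF assms] by (meson converseD)
  then show "x = y" using forced_real_unique assms by (metis self_coded_def from_nat_to_nat)
qed

lemma self_coded_Union_chain:
  assumes "subset.chain {P. self_coded F P} \<C>"
  shows "self_coded F (\<Union>\<C>)"
  unfolding self_coded_def
proof (intro conjI)
  show "single_valued (\<Union>\<C>)"
  proof (rule single_valuedI)
    fix x c d
    assume "(x, c) \<in> \<Union>\<C>" "(x, d) \<in> \<Union>\<C>"
    then obtain P Q where "P \<in> \<C>" "Q \<in> \<C>" "(x, c) \<in> P" "(x, d) \<in> Q" by blast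
    moreover from this have "P \<subseteq> Q \<or> Q \<subseteq> P" "self_coded F P" "self_coded F Q"
      using assms by (auto simp: subset_chain_def)
    ultimately show "c = d" by (auto simp: self_coded_def dest: single_valuedD)
  qed
  show "\<forall>(x, c)\<in>\<Union>\<C>. \<exists>i. c = to_nat i \<and> forced_real F (\<Union>\<C>) i x"
  proof (intro ballI, clarify)
    fix x c P
    assume P: "P \<in> \<C>" and "(x, c) \<in> P"
    moreover have "self_coded F P" using assms P by (auto simp: subset_chain_def)
    ultimately obtain i where "c = to_nat i" "forced_real F P i x"
      using self_coded_forced_real by blast
    then show "\<exists>i. c = to_nat i \<and> forced_real F (\<Union>\<C>) i x"
      using forced_real_mono[OF _ Union_upper[OF P]] by blast
  qed
qed

text \<open>Forced computations stay forced when \<open>P\<close> grows, and a new \<open>x\<close>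
  cannot get two codes. Injectivity is then a consequence of \<open>self_coded\<close>.\<close>

lemma self_coded_insert:
  assumes "self_coded F P" "forced_real F P i x" "x \<notin> Domain P"
  shows "self_coded F (insert (x, to_nat i) P)"
  unfolding self_coded_def
proof (intro conjI)
  show "single_valued (insert (x, to_nat i) P)"
    using assms unfolding self_coded_def single_valued_def by blast
  show "\<forall>(y, c)\<in>insert (x, to_nat i) P. \<exists>j. c = to_nat j \<and> forced_real F (insert (x, to_nat i) P) j y"
    using assms(1,2) forced_real_mono[OF _ subset_insertI] unfolding self_coded_def by fast
qed

lemma closed_self_coded_exists:
  "\<exists>P. self_coded F P \<and> (\<forall>i x. forced_real F P i x \<longrightarrow> x \<in> Domain P)"
proof -
  obtain P where P: "self_coded F P" "\<And>Q. self_coded F Q \<Longrightarrow> P \<subseteq> Q \<Longrightarrow> Q = P"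
    using subset_Zorn'[of "{P. self_coded F P}"] self_coded_Union_chain by blast
  have "x \<in> Domain P" if "forced_real F P i x" for i x
    using self_coded_insert[OF P(1) that] P(2)[of "insert (x, to_nat i) P"] by blast
  then show ?thesis using P(1) by blast
qed

lemma map_move_to_front:
  "k < length xs \<Longrightarrow> map f (move_to_front k xs) = move_to_front k (map f xs)"
  by (simp add: move_to_front_def take_map drop_map)

text \<open>\<open>F\<close> does not depend on the input; at a real in \<open>Domain P\<close>,
  every extending input answers 1 for membership and the value given by \<open>P\<close>.\<close>

lemma named_input_eq_on_Domain:
  assumes "input_extends P A Y" "input_extends P B Z" "unit_real u \<in> Domain P"
  shows "named_input F A Y t u = named_input F B Z t u"
  using assms by (auto simp: named_input_def input_extends_def set_functional_def fun_functional_def)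

text \<open>Induction on the computation, in which only S8 consults the input. The names
  \<open>ts\<close> vary because S6 and S9 change the list.\<close>

lemma kleene_forced:
  assumes closed: "\<And>i x. forced_real F P i x \<Longrightarrow> x \<in> Domain P"
    and AY: "input_extends P A Y"
  shows "kleene e as fs Gs c \<Longrightarrow> fs = [] \<Longrightarrow> Gs = map (named_input F A Y) ts \<Longrightarrow> forced F P e as ts c"
proof (induction arbitrary: ts rule: kleene.induct)
  case S1 then show ?case unfolding forced_def by (blast intro: kleene.S1)
next
  case S2 then show ?case unfolding forced_def by (blast intro: kleene.S2)
next
  case S3 then show ?case unfolding forced_def by (blast intro: kleene.S3)
next
  case S4 show ?case
    using S4.IH[OF S4.prems] unfolding forced_def by (blast intro: kleene.S4)
next
  case S5_0 show ?case
    using S5_0.IH[OF S5_0.prems] unfolding forced_def by (blast intro: kleene.S5_0)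
next
  case S5_Suc show ?case
    using S5_Suc.IH[OF S5_Suc.prems] unfolding forced_def by (blast intro: kleene.S5_Suc)
next
  case S6_0 show ?case
    using S6_0.IH[OF S6_0.prems] S6_0.hyps(1) unfolding forced_def by (blast intro: kleene.S6_0)
next
  case S6_1 then show ?case by simp
next
  case (S6_2 k Gs g as fs c)
  then have "k < length ts" by simp
  moreover have "forced F P g as (move_to_front k ts) c"
    using S6_2 by (simp add: map_move_to_front)
  ultimately show ?case by (auto simp: forced_def map_move_to_front simp del: list_encode.simps intro: kleene.S6_2)
next
  case S7 then show ?case by simp
next
  case (S8 h as fs G Gs u)
  from S8.prems obtain t ts' where ts: "ts = t # ts'" "G = named_input F A Y t" by auto
  have u: "forced F P h (n # as) ts (u n)" for n by (rule S8.IH[OF S8.prems])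
  \<comment> \<open>The queried sequence is itself computed in a forced way, so closure puts its
    real into \<open>Domain P\<close>, where all extending inputs agree.\<close>
  then have "forced_real F P (h, as, ts) (unit_real u)" by (auto simp: forced_real_def)
  then have "unit_real u \<in> Domain P" by (rule closed)
  then have eq: "named_input F B Z t u = G u" if "input_extends P B Z" for B Z
    using named_input_eq_on_Domain that AY ts(2) by blast
  show ?case unfolding forced_def
  proof (intro allI impI)
    fix B Z assume BZ: "input_extends P B Z"
    have "kleene (list_encode [8, 2, h]) as [] (map (named_input F B Z) ts) (named_input F B Z t u)"
      using u BZ unfolding forced_def ts(1) list.map by (intro kleene.S8) blast
    then show "kleene (list_encode [8, 2, h]) as [] (map (named_input F B Z) ts) (G u)"
      by (simp only: eq[OF BZ])
  qed
next
  case (S9 m\<^sub>0 as m\<^sub>1 fs m\<^sub>2 Gs a c)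
  have "forced F P a (take m\<^sub>0 as) (take m\<^sub>2 ts) c"
    using S9 by (simp add: take_map)
  then show ?case using S9 by (auto simp: forced_def take_map simp del: list_encode.simps intro!: kleene.S9)
qed

lemma bij_extension_exists:
  assumes "self_coded F P"
  shows "\<exists>A Y. A \<subseteq> {0..1} \<and> Y \<in> {0..1} \<rightarrow>\<^sub>E UNIV \<and> bij_betw Y A UNIV \<and> input_extends P A Y"
proof -
  have fwd: "c = d" if "(x, c) \<in> P" "(x, d) \<in> P" for x c d
    using assms that by (auto simp: self_coded_def dest: single_valuedD)
  have bwd: "x = y" if "(x, c) \<in> P" "(y, c) \<in> P" for x y c
    using self_coded_inverse_single_valued[OF assms] that by (auto dest: single_valuedD)
  have dom: "Domain P \<subseteq> {0..1}"
    using self_coded_forced_real[OF assms] forced_real_in_unit by blast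
  have "countable (Domain P)"
  proof -
    have "inj_on (\<lambda>x. SOME c. (x, c) \<in> P) (Domain P)"
      by (rule inj_onI) (metis Domain_iff bwd someI_ex)
    then show ?thesis by (rule countableI)
  qed
  then have "infinite ({0..1} - Domain P)"
    using uncountable_closed_interval[of 0 "1::real"]
    by (metis uncountable_minus_countable uncountable_infinite zero_less_one)
  then obtain j :: "nat \<Rightarrow> real" where j: "inj j" "range j \<subseteq> {0..1} - Domain P"
    using infinite_countable_subset by blast
  define Q where "Q = P \<union> {(j c, c) | c. c \<notin> Range P}"
  have Qfwd: "c = d" if "(x, c) \<in> Q" "(x, d) \<in> Q" for x c d
    using that fwd j unfolding Q_def inj_def by blast
  have Qbwd: "x = y" if "(x, c) \<in> Q" "(y, c) \<in> Q" for x y c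
    using that bwd unfolding Q_def by blast
  have Qdom: "Domain Q \<subseteq> {0..1}" using dom j(2) unfolding Q_def by blast
  \<comment> \<open>Bijectivity only concerns \<open>Domain Q\<close>, so values elsewhere in the
    unit interval may be arbitrary; \<open>restrict\<close> makes \<open>Y\<close>
    extensional.\<close>
  define Y where "Y = restrict (\<lambda>x. SOME c. (x, c) \<in> Q) {0..1}"
  have Y: "Y x = c" if "(x, c) \<in> Q" for x c
  proof -
    have "x \<in> {0..1}" using that Qdom by blast
    moreover have "(SOME c. (x, c) \<in> Q) = c" using that Qfwd by (blast intro: some_equality)
    ultimately show ?thesis unfolding Y_def by simp
  qed
  have "bij_betw Y (Domain Q) UNIV"
  proof (rule bij_betwI')
    show "Y x = Y y \<longleftrightarrow> x = y" if "x \<in> Domain Q" "y \<in> Domain Q" for x y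
      using that Y Qbwd by (metis DomainE)
    show "\<exists>x\<in>Domain Q. c = Y x" for c
    proof -
      have "\<exists>x. (x, c) \<in> Q" unfolding Q_def by blast
      then show ?thesis using Y by blast
    qed
  qed simp
  moreover have "input_extends P (Domain Q) Y"
    using Y unfolding input_extends_def Q_def by blast
  moreover have "Y \<in> {0..1} \<rightarrow>\<^sub>E UNIV" by (simp add: Y_def)
  ultimately show ?thesis using Qdom by blast
qed

theorem theorem3p11:
  shows "\<not> (\<exists>(F :: (nat \<Rightarrow> nat) \<Rightarrow> nat) C. weak_cantor_realiser C \<and> kleene_computable_in F C)"
proof clarify
  fix F :: "(nat \<Rightarrow> nat) \<Rightarrow> nat" and C
  assume C: "weak_cantor_realiser C" and comp: "kleene_computable_in F C"
  obtain P where P: "self_coded F P" and closed: "\<And>i x. forced_real F P i x \<Longrightarrow> x \<in> Domain P"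
    using closed_self_coded_exists by blast
  obtain A Y where AY: "A \<subseteq> {0..1}" "Y \<in> {0..1} \<rightarrow>\<^sub>E UNIV" "bij_betw Y A UNIV"
    and ext: "input_extends P A Y"
    using bij_extension_exists[OF P] by blast
  obtain x where x: "C A Y = Some x" "x \<notin> A"
    using C AY unfolding weak_cantor_realiser_def by blast
  obtain e f where f: "\<And>n. kleene e [n] [] [F, set_functional A, fun_functional Y] (f n)"
    "unit_real f = x"
    using comp AY(1,2) x(1) unfolding kleene_computable_in_def by blast
  \<comment> \<open>The names 0, 1, 2 stand for \<open>F\<close>, \<open>A\<close>,
    \<open>Y\<close>. The output is thus a forced real like any queried one, and closure applies to
    it as well.\<close>
  have "forced F P e [n] [0, 1, 2] (f n)" for n
    using kleene_forced[OF closed ext f(1)] by (simp add: named_input_def)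
  then have "forced_real F P (e, [], [0, 1, 2]) x"
    using f(2) by (auto simp: forced_real_def)
  then have "x \<in> Domain P" by (rule closed)
  then have "x \<in> A" using ext by (auto simp: input_extends_def)
  then show False using x(2) by blast
qed

end
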